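(* For $0<c\le\frac{2}{\sqrt3}$ let $s_{int}(c)$ be the smallest $s>0$ with $y_c(s)=0$, and let $x_{int}(c)=x_c(s_{int}(c))$, where $(x_c,y_c)$ are the projected sub-Riemannian geodesics described in the context. Let $\bar s$ be the unique solution of $\tan s=s$ in $(\pi,\frac{3\pi}{2})$. Then: 1. For $c\in(0,1)$, $\frac{\pi}{c}<s_{int}(c)<\frac{3\pi}{2c}$; $s_{int}$ is a differentiable decreasing function of $c$ on $(0,1)$, with $\lim_{c\to0^+}s_{int}(c)=\infty$ and $\lim_{c\to1^-}s_{int}(c)=\bar s$. Moreover $x_{int}(c)<0$, $|x_{int}(c)|$ is a decreasing function of $c$ on $(0,1)$, $\lim_{c\to0^+}|x_{int}(c)|=\infty$ and $\lim_{c\to1^-}|x_{int}(c)|=\sqrt{1+\bar s^2}$. 2. On $(1,\frac{2}{\sqrt3})$, $s_{int}$ is continuous, decreasing for $1<c<\frac{3}{2\sqrt2}$ and increasing for $\frac{3}{2\sqrt2}<c<\frac{2}{\sqrt3}$, with $s_{int}\left(\frac{3}{2\sqrt2}\right)=\pi\sqrt2$, $\lim_{c\to1^+}s_{int}(c)=\bar s$ and $\lim_{c\to\frac{2}{\sqrt3}^-}s_{int}(c)=\sqrt3\,\pi$. Moreover $|x_{int}(c)|$ is a decreasing function of $c$ on $(1,\frac{2}{\sqrt3})$, with $\lim_{c\to1^+}|x_{int}(c)|=\sqrt{1+\bar s^2}$ and $\lim_{c\to\frac{2}{\sqrt3}^-}|x_{int}(c)|=1$.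
   Context: For $c>0$, $s\ge0$, set $x_c(s)=k_1\cos(cs)+k_2\sin(cs)$ and $y_c(s)=k_1\sin(cs)-k_2\cos(cs)$, where for $0<c<1$: $k_1=\cosh(\sqrt{1-c^2}\,s)$, $k_2=\frac{c}{\sqrt{1-c^2}}\sinh(\sqrt{1-c^2}\,s)$; for $c=1$: $k_1=1$, $k_2=s$; for $c>1$: $k_1=\cos(\sqrt{c^2-1}\,s)$, $k_2=\frac{c}{\sqrt{c^2-1}}\sin(\sqrt{c^2-1}\,s)$. (These curves, starting at $(1,0)$, are the projections to the quotient of $SL(2,\mathbb{R})$ by the conjugation action of $SO(2)$ of sub-Riemannian geodesics from the identity.) *)

theory Defs
  imports "HOL-Analysis.Analysis"
begin

definition k1 :: "real \<Rightarrow> real \<Rightarrow> real" where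
  "k1 c s =
     (if c < 1 then cosh (sqrt (1 - c\<^sup>2) * s)
      else if c = 1 then 1
      else cos (sqrt (c\<^sup>2 - 1) * s))"

definition k2 :: "real \<Rightarrow> real \<Rightarrow> real" where
  "k2 c s =
     (if c < 1 then c / sqrt (1 - c\<^sup>2) * sinh (sqrt (1 - c\<^sup>2) * s)
      else if c = 1 then s
      else c / sqrt (c\<^sup>2 - 1) * sin (sqrt (c\<^sup>2 - 1) * s))"

text \<open>Only the range \<open>c > 0\<close>, \<open>s \<ge> 0\<close> is meaningful in this and the following definitions.
  The curve \<open>s \<mapsto> (geo_x c s, geo_y c s)\<close> starts at \<open>(1, 0)\<close>; it is the projection of a
  sub-Riemannian geodesic from the identity to the quotient of \<open>SL(2, \<real>)\<close> by the
  conjugation action of \<open>SO(2)\<close>.\<close>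

definition geo_x :: "real \<Rightarrow> real \<Rightarrow> real" where
  "geo_x c s = k1 c s * cos (c * s) + k2 c s * sin (c * s)"

definition geo_y :: "real \<Rightarrow> real \<Rightarrow> real" where
  "geo_y c s = k1 c s * sin (c * s) - k2 c s * cos (c * s)"

text \<open>On the reals, \<open>LEAST\<close> and \<open>THE\<close> return an unspecified value unless the least element,
  respectively the unique solution, exists; this existence has to be established separately.\<close>

definition s_int :: "real \<Rightarrow> real" where
  "s_int c = (LEAST s. 0 < s \<and> geo_y c s = 0)"

definition x_int :: "real \<Rightarrow> real" where
  "x_int c = geo_x c (s_int c)"

definition s_bar :: real where
  "s_bar = (THE s. s \<in> {pi<..<3 * pi / 2} \<and> tan s = s)"

end

theory Submission
  imports Defs
begin

text \<open>In \<open>s\<close> one has \<open>x' = k2 cos (c s) / c\<close> and \<open>y' = k2 sin (c s) / c\<close>, and \<open>k2 > 0\<close> on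
  \<open>(0, 2 \<pi> / c)\<close> as long as \<open>c \<le> 2 / \<surd>3\<close>. So \<open>y\<close> first increases from \<open>0\<close>, then decreases on
  \<open>[\<pi> / c, 2 \<pi> / c]\<close> to a value \<open>\<le> 0\<close>, and \<open>s_int c\<close> is its only zero in \<open>(0, 2 \<pi> / c]\<close>; the sign of
  \<open>y\<close> and the joint continuity of \<open>k1\<close>, \<open>k2\<close> (also at \<open>c = 1\<close>) make \<open>s_int\<close> continuous.
  For \<open>c \<noteq> 1\<close> the derivatives in \<open>c\<close> are \<open>cos (c s) E\<close> for \<open>y\<close> and \<open>- sin (c s) E\<close> for \<open>x\<close>, with
  \<open>E = (s k1 - k2 / c) / (1 - c\<^sup>2) > 0\<close>. Implicit differentiation gives
  \<open>s_int' = - c cot (c s) E / k2\<close>, whose sign is that of \<open>cos (c s)\<close> and changes where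
  \<open>c s = 3 \<pi> / 2\<close>, that is where \<open>k1 = 0\<close>, and \<open>x_int' = - E / sin (c s) > 0\<close>.\<close>


section \<open>Derivatives along the curve, in \<open>s\<close>\<close>

lemma k1_0 [simp]: "k1 c 0 = 1" and k2_0 [simp]: "k2 c 0 = 0"
  by (simp_all add: k1_def k2_def)

lemma less_one_imp_pos:
  fixes c :: real assumes "0 < c" "c < 1" shows "0 < 1 - c\<^sup>2"
  using assms by (simp add: power_less_one_iff)

lemma greater_one_imp_pos:
  fixes c :: real assumes "1 < c" shows "0 < c\<^sup>2 - 1"
  using assms by (simp add: one_less_power)

text \<open>Together with \<open>DERIV_k2\<close>: all three branches solve one linear system in
  \<open>s\<close>, so the derivatives of \<open>geo_x\<close> and \<open>geo_y\<close> need no case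
  distinction on \<open>c\<close>.\<close>

lemma DERIV_k1:
  assumes "0 < c"
  shows "(k1 c has_real_derivative (1 - c\<^sup>2) / c * k2 c s) (at s)"
proof -
  consider "c < 1" | "c = 1" | "c > 1" by linarith
  then show ?thesis
  proof cases
    case 1
    define w where "w = sqrt (1 - c\<^sup>2)"
    have w: "w > 0" "w * w = 1 - c\<^sup>2"
      using less_one_imp_pos[OF assms 1] by (auto simp: w_def)
    have e: "k1 c = (\<lambda>s. cosh (w * s))" "k2 c s = c / w * sinh (w * s)"
      using 1 by (auto simp: k1_def k2_def w_def fun_eq_iff)
    show ?thesis unfolding e
      by (rule derivative_eq_intros refl)+ (use w assms in \<open>simp add: field_simps flip: w(2)\<close>)
  next
    case 2
    then have "k1 c = (\<lambda>s. 1)" by (simp add: k1_def fun_eq_iff)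
    with 2 show ?thesis by simp
  next
    case 3
    define w where "w = sqrt (c\<^sup>2 - 1)"
    have w: "w > 0" "c\<^sup>2 = 1 + w * w"
      using greater_one_imp_pos[OF 3] by (auto simp: w_def)
    have e: "k1 c = (\<lambda>s. cos (w * s))" "k2 c s = c / w * sin (w * s)"
      using 3 by (auto simp: k1_def k2_def w_def fun_eq_iff)
    show ?thesis unfolding e
      by (rule derivative_eq_intros refl)+ (use w(1) assms in \<open>simp add: w(2) field_simps\<close>)
  qed
qed

lemma DERIV_k2:
  assumes "0 < c"
  shows "(k2 c has_real_derivative c * k1 c s) (at s)"
proof -
  consider "c < 1" | "c = 1" | "c > 1" by linarith
  then show ?thesis
  proof cases
    case 1
    define w where "w = sqrt (1 - c\<^sup>2)"
    have w: "w > 0"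
      using less_one_imp_pos[OF assms 1] by (auto simp: w_def)
    have e: "k2 c = (\<lambda>s. c / w * sinh (w * s))" "k1 c s = cosh (w * s)"
      using 1 by (auto simp: k1_def k2_def w_def fun_eq_iff)
    show ?thesis unfolding e
      by (rule derivative_eq_intros refl)+ (use w assms in \<open>simp add: field_simps\<close>)
  next
    case 2
    then have "k2 c = (\<lambda>s. s)" "k1 c s = 1" by (simp_all add: k1_def k2_def fun_eq_iff)
    with 2 show ?thesis by simp
  next
    case 3
    define w where "w = sqrt (c\<^sup>2 - 1)"
    have w: "w > 0"
      using greater_one_imp_pos[OF 3] by (auto simp: w_def)
    have e: "k2 c = (\<lambda>s. c / w * sin (w * s))" "k1 c s = cos (w * s)"
      using 3 by (auto simp: k1_def k2_def w_def fun_eq_iff)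
    show ?thesis unfolding e
      by (rule derivative_eq_intros refl)+ (use w assms in \<open>simp add: field_simps\<close>)
  qed
qed

text \<open>The terms in \<open>k1\<close> cancel and the coefficients of \<open>k2\<close> add up,
  \<open>(1 - c^2) / c + c = 1 / c\<close>. The same happens for \<open>geo_y\<close>.\<close>

lemma DERIV_geo_x:
  assumes "0 < c"
  shows "(geo_x c has_real_derivative k2 c s * cos (c * s) / c) (at s)"
proof -
  have "((\<lambda>s. k1 c s * cos (c * s) + k2 c s * sin (c * s)) has_real_derivative
      k2 c s * cos (c * s) / c) (at s)"
    by (rule derivative_eq_intros DERIV_k1[OF assms] DERIV_k2[OF assms] refl)+
      (use assms in \<open>simp add: field_simps power2_eq_square\<close>)
  then show ?thesis by (simp add: geo_x_def[abs_def])
qed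

lemma DERIV_geo_y:
  assumes "0 < c"
  shows "(geo_y c has_real_derivative k2 c s * sin (c * s) / c) (at s)"
proof -
  have "((\<lambda>s. k1 c s * sin (c * s) - k2 c s * cos (c * s)) has_real_derivative
      k2 c s * sin (c * s) / c) (at s)"
    by (rule derivative_eq_intros DERIV_k1[OF assms] DERIV_k2[OF assms] refl)+
      (use assms in \<open>simp add: field_simps power2_eq_square\<close>)
  then show ?thesis by (simp add: geo_y_def[abs_def])
qed

section \<open>Positivity of \<open>k2\<close>, the sign of \<open>geo_y\<close>, and the first
  zero\<close>

lemma frequency_le_half:
  fixes c :: real
  assumes "0 < c" "c \<le> 2 / sqrt 3"
  shows "sqrt (c\<^sup>2 - 1) \<le> c / 2"
proof -
  have "c\<^sup>2 \<le> (2 / sqrt 3)\<^sup>2" using assms by (intro power_mono) auto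
  \<comment> \<open>\<open>c^2 <= 4 / 3\<close> is the same as
    \<open>c^2 - 1 <= c^2 / 4\<close>.\<close>
  then have "c\<^sup>2 - 1 \<le> (c / 2)\<^sup>2" by (simp add: power_divide)
  then show ?thesis using assms by (intro real_le_lsqrt) auto
qed

text \<open>For \<open>c > 1\<close> the frequency of \<open>k2\<close> is at most
  \<open>c / 2\<close>, so the argument of its sine stays below \<open>pi\<close> up to
  \<open>s = 2 * pi / c\<close>. This is where the bound \<open>2 / sqrt 3\<close> enters.\<close>

lemma k2_pos:
  assumes "0 < c" "c \<le> 2 / sqrt 3" "0 < s" "s < 2 * pi / c"
  shows "0 < k2 c s"
proof -
  consider "c < 1" | "c = 1" | "c > 1" by linarith
  then show ?thesis
  proof cases
    case 1
    then show ?thesis using less_one_imp_pos[OF assms(1) 1] assms by (simp add: k2_def)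
  next
    case 3
    have "sqrt (c\<^sup>2 - 1) * s \<le> c / 2 * s"
      using frequency_le_half assms by (intro mult_right_mono) auto
    also have "\<dots> < pi" using assms by (simp add: field_simps)
    finally have "0 < sin (sqrt (c\<^sup>2 - 1) * s)"
      using greater_one_imp_pos[OF 3] assms by (intro sin_gt_zero) auto
    then show ?thesis using greater_one_imp_pos[OF 3] 3 by (simp add: k2_def)
  qed (use assms in \<open>simp add: k2_def\<close>)
qed

text \<open>At \<open>c = 2 / sqrt 3\<close> the value is \<open>0\<close>, so only the weak
  inequality holds; it follows from \<open>k2_pos\<close> by a limit from the left.\<close>

lemma k2_nonneg_end:
  assumes "0 < c" "c \<le> 2 / sqrt 3"
  shows "0 \<le> k2 c (2 * pi / c)"
proof (rule tendsto_lowerbound)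
  have "isCont (k2 c) (2 * pi / c)" using DERIV_k2[OF assms(1)] DERIV_isCont by blast
  then show "(k2 c \<longlongrightarrow> k2 c (2 * pi / c)) (at_left (2 * pi / c))"
    by (simp add: isCont_def filterlim_at_split)
  have "\<forall>\<^sub>F s in at_left (2 * pi / c). s \<in> {0<..<2 * pi / c}"
    using assms by (intro eventually_at_left_real) auto
  then show "\<forall>\<^sub>F s in at_left (2 * pi / c). 0 \<le> k2 c s"
    by eventually_elim (use k2_pos[OF assms] in force)
qed simp

lemma geo_y_pos_initial:
  assumes "0 < c" "c \<le> 2 / sqrt 3" "0 < s" "s \<le> pi / c"
  shows "0 < geo_y c s"
proof -
  have "geo_y c 0 < geo_y c s"
  proof (rule DERIV_pos_imp_increasing_open[OF \<open>0 < s\<close>])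
    fix t assume t: "0 < t" "t < s"
    have "0 < sin (c * t)"
    proof (rule sin_gt_zero)
      have "t < pi / c" using t assms by linarith
      then show "c * t < pi" using assms by (simp add: field_simps)
    qed (use t assms in auto)
    moreover have "0 < k2 c t"
    proof (rule k2_pos)
      have "pi / c < 2 * pi / c" using assms by (simp add: field_simps)
      then show "t < 2 * pi / c" using t assms by linarith
    qed (use t assms in auto)
    ultimately show "\<exists>d. (geo_y c has_real_derivative d) (at t) \<and> 0 < d"
      using DERIV_geo_y[OF assms(1), of t] assms(1) by (meson divide_pos_pos mult_pos_pos)
  qed (use DERIV_geo_y[OF assms(1)] in \<open>meson continuous_at_imp_continuous_on DERIV_isCont\<close>)
  then show ?thesis by (simp add: geo_y_def)
qed

lemma geo_y_decreasing:
  assumes "0 < c" "c \<le> 2 / sqrt 3" "pi / c \<le> s" "s < t" "t \<le> 2 * pi / c"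
  shows "geo_y c t < geo_y c s"
proof (rule DERIV_neg_imp_decreasing_open[OF \<open>s < t\<close>])
  fix r assume r: "s < r" "r < t"
  then have "pi / c < r" "r < 2 * pi / c" using assms by linarith+
  moreover from this have "0 < r" using assms by (meson divide_pos_pos less_trans pi_gt_zero)
  ultimately have "sin (c * r) < 0" "0 < k2 c r"
    using assms by (auto intro!: k2_pos sin_lt_zero simp: field_simps)
  then show "\<exists>d. (geo_y c has_real_derivative d) (at r) \<and> d < 0"
    using DERIV_geo_y[OF assms(1), of r] assms(1)
    by (meson divide_neg_pos mult_pos_neg)
qed (use DERIV_geo_y[OF assms(1)] in \<open>meson continuous_at_imp_continuous_on DERIV_isCont\<close>)

lemma s_int_sign:
  assumes "0 < c" "c \<le> 2 / sqrt 3"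
  shows s_int_gt: "pi / c < s_int c"
    and s_int_le: "s_int c \<le> 2 * pi / c"
    and geo_y_s_int: "geo_y c (s_int c) = 0"
    and geo_y_pos: "\<And>s. 0 < s \<Longrightarrow> s < s_int c \<Longrightarrow> 0 < geo_y c s"
    and geo_y_neg: "\<And>s. s_int c < s \<Longrightarrow> s \<le> 2 * pi / c \<Longrightarrow> geo_y c s < 0"
proof -
  have le: "pi / c \<le> 2 * pi / c" and pos: "0 < pi / c" using assms by (auto simp: field_simps)
  \<comment> \<open>Here the sine is \<open>0\<close> and the cosine is \<open>1\<close>.\<close>
  have "geo_y c (2 * pi / c) = - k2 c (2 * pi / c)" using assms by (simp add: geo_y_def)
  then have "geo_y c (2 * pi / c) \<le> 0" using k2_nonneg_end[OF assms] by simp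
  moreover have y: "0 < geo_y c (pi / c)" using geo_y_pos_initial[OF assms pos] by simp
  ultimately obtain z where z: "pi / c \<le> z" "z \<le> 2 * pi / c" "geo_y c z = 0"
    using IVT2[of "geo_y c" "2 * pi / c" 0 "pi / c"] le DERIV_geo_y[OF assms(1)] DERIV_isCont
    by (metis less_imp_le)
  have gt: "pi / c < z" using z y by (cases "z = pi / c") auto
  have zpos: "0 < geo_y c s" if "0 < s" "s < z" for s
  proof (cases "s \<le> pi / c")
    case True
    then show ?thesis using geo_y_pos_initial[OF assms] that by simp
  next
    case False
    then show ?thesis using geo_y_decreasing[OF assms, of s z] that z by simp
  qed
  \<comment> \<open>\<open>LEAST\<close> is attained: \<open>z\<close> is a positive zero, and
    \<open>geo_y\<close> is positive at every smaller positive argument.\<close>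
  have eq: "s_int c = z" unfolding s_int_def
    by (rule Least_equality) (use z gt pos zpos in \<open>force simp: not_less\<close>)+
  show "pi / c < s_int c" "s_int c \<le> 2 * pi / c" "geo_y c (s_int c) = 0"
    "\<And>s. 0 < s \<Longrightarrow> s < s_int c \<Longrightarrow> 0 < geo_y c s"
    using eq gt z zpos by auto
  show "\<And>s. s_int c < s \<Longrightarrow> s \<le> 2 * pi / c \<Longrightarrow> geo_y c s < 0"
    using geo_y_decreasing[OF assms, of z] eq gt z by simp
qed

lemma s_int_pos:
  assumes "0 < c" "c \<le> 2 / sqrt 3" shows "0 < s_int c"
  using s_int_gt[OF assms] assms(1) by (meson divide_pos_pos less_trans pi_gt_zero)

text \<open>This evaluates \<open>s_int\<close> at special parameters: it is enough to exhibit a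
  zero in \<open>(0, 2 * pi / c]\<close>.\<close>

lemma s_int_unique:
  assumes "0 < c" "c \<le> 2 / sqrt 3" "0 < s" "s \<le> 2 * pi / c" "geo_y c s = 0"
  shows "s = s_int c"
  using geo_y_pos[OF assms(1-3)] geo_y_neg[OF assms(1,2) _ assms(4)] assms(5)
  by (metis less_irrefl linorder_neqE_linordered_idom)

section \<open>Joint continuity in \<open>(c, s)\<close> and continuity of
  \<open>s_int\<close>\<close>

lemma continuous_difference_quotient:
  fixes f :: "real \<Rightarrow> real"
  assumes "(f has_real_derivative D) (at 0)" "f 0 = 0" "continuous_on UNIV f"
  shows "continuous_on UNIV (\<lambda>u. if u = 0 then D else f u / u)"
proof -
  have "isCont (\<lambda>u. if u = 0 then D else f u / u) x" for x
  proof (cases "x = 0")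
    case True
    have "((\<lambda>u. f u / u) \<longlongrightarrow> D) (at 0)" using assms(1,2) by (simp add: has_field_derivative_iff)
    then have "((\<lambda>u. if u = 0 then D else f u / u) \<longlongrightarrow> D) (at 0)"
      by (rule Lim_transform_eventually) (auto simp: eventually_at_filter)
    then show ?thesis using True by (simp add: isCont_def)
  next
    case False
    then have "isCont (\<lambda>u. f u / u) x"
      using assms(3) by (intro continuous_intros) (auto simp: continuous_on_eq_continuous_at)
    moreover have "\<forall>\<^sub>F u in nhds x. (if u = 0 then D else f u / u) = f u / u"
      using t1_space_nhds[OF False] by eventually_elim simp
    ultimately show ?thesis by (simp add: isCont_cong)
  qed
  then show ?thesis by (simp add: continuous_at_imp_continuous_on)
qed

lemma isCont_k1:
  assumes "0 < c"
  shows "isCont (\<lambda>p. k1 (fst p) (snd p)) (c, s)"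
proof -
  \<comment> \<open>At \<open>c = 1\<close> both frequencies vanish and both formulas give
    \<open>1\<close>, so the branches can be glued along two closed sets.\<close>
  let ?g = "\<lambda>p. if fst p \<le> (1::real) then cosh (sqrt (1 - (fst p)\<^sup>2) * snd p)
    else cos (sqrt ((fst p)\<^sup>2 - 1) * snd p)"
  have "continuous_on UNIV ?g"
  proof -
    have "continuous_on ({p. fst p \<le> (1::real)} \<union> {p. 1 \<le> fst p}) ?g"
      by (intro continuous_on_cases closed_Collect_le continuous_intros) (auto simp: cosh_0)
    moreover have "{p. fst p \<le> (1::real)} \<union> {p. 1 \<le> fst p} = (UNIV :: (real \<times> real) set)"
      by auto
    ultimately show ?thesis by metis
  qed
  then have "isCont ?g (c, s)" by (simp add: continuous_on_eq_continuous_at)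
  moreover have "\<forall>\<^sub>F p in nhds (c, s). p \<in> {p. 0 < fst p}"
    using assms by (intro eventually_nhds_in_open open_Collect_less continuous_intros) auto
  then have "\<forall>\<^sub>F p in nhds (c, s). k1 (fst p) (snd p) = ?g p"
    by eventually_elim (auto simp: k1_def)
  ultimately show ?thesis using isCont_cong by force
qed

lemma isCont_k2:
  assumes "0 < c"
  shows "isCont (\<lambda>p. k2 (fst p) (snd p)) (c, s)"
proof -
  \<comment> \<open>\<open>sh\<close> and \<open>sc\<close> fill the removable singularities at
    \<open>0\<close>. Factoring \<open>c * s\<close> out of \<open>k2\<close> then leaves no
    division by the frequency, and at \<open>c = 1\<close> both branches give
    \<open>s\<close>.\<close>
  define sh :: "real \<Rightarrow> real" where "sh = (\<lambda>u. if u = 0 then 1 else sinh u / u)"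
  define sc :: "real \<Rightarrow> real" where "sc = (\<lambda>u. if u = 0 then 1 else sin u / u)"
  have "(sinh has_real_derivative 1) (at (0::real))"
    by (rule derivative_eq_intros refl)+ simp
  then have sh: "continuous_on UNIV sh" unfolding sh_def
    by (intro continuous_difference_quotient continuous_intros) auto
  have "(sin has_real_derivative 1) (at (0::real))"
    by (rule derivative_eq_intros refl)+ simp
  then have sc: "continuous_on UNIV sc" unfolding sc_def
    by (intro continuous_difference_quotient continuous_intros) auto
  let ?g = "\<lambda>p. if fst p \<le> (1::real) then fst p * snd p * sh (sqrt (1 - (fst p)\<^sup>2) * snd p)
    else fst p * snd p * sc (sqrt ((fst p)\<^sup>2 - 1) * snd p)"
  have "continuous_on UNIV ?g"
  proof -
    have "continuous_on ({p. fst p \<le> (1::real)} \<union> {p. 1 \<le> fst p}) ?g"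
      by (intro continuous_on_cases closed_Collect_le continuous_intros
          continuous_on_compose2[OF sh] continuous_on_compose2[OF sc])
        (auto simp: sh_def sc_def)
    moreover have "{p. fst p \<le> (1::real)} \<union> {p. 1 \<le> fst p} = (UNIV :: (real \<times> real) set)"
      by auto
    ultimately show ?thesis by metis
  qed
  then have "isCont ?g (c, s)" by (simp add: continuous_on_eq_continuous_at)
  moreover have "\<forall>\<^sub>F p in nhds (c, s). p \<in> {p. 0 < fst p}"
    using assms by (intro eventually_nhds_in_open open_Collect_less continuous_intros) auto
  then have "\<forall>\<^sub>F p in nhds (c, s). k2 (fst p) (snd p) = ?g p"
  proof eventually_elim
    case (elim p)
    then have "0 < fst p" by simp
    then show ?case
      using less_one_imp_pos[of "fst p"] greater_one_imp_pos[of "fst p"]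
      by (cases "fst p" "1::real" rule: linorder_cases) (auto simp: k2_def sh_def sc_def power2_eq_1_iff)
  qed
  ultimately show ?thesis using isCont_cong by force
qed

lemma tendsto_k1:
  assumes "(f \<longlongrightarrow> c) F" "(g \<longlongrightarrow> s) F" "0 < c"
  shows "((\<lambda>x. k1 (f x) (g x)) \<longlongrightarrow> k1 c s) F"
  using isCont_tendsto_compose[OF isCont_k1[OF assms(3)] tendsto_Pair[OF assms(1,2)]] by simp

lemma tendsto_k2:
  assumes "(f \<longlongrightarrow> c) F" "(g \<longlongrightarrow> s) F" "0 < c"
  shows "((\<lambda>x. k2 (f x) (g x)) \<longlongrightarrow> k2 c s) F"
  using isCont_tendsto_compose[OF isCont_k2[OF assms(3)] tendsto_Pair[OF assms(1,2)]] by simp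

lemma tendsto_geo_y:
  fixes f g :: "'a::t2_space \<Rightarrow> real"
  assumes "(f \<longlongrightarrow> c) F" "(g \<longlongrightarrow> s) F" "0 < c"
  shows "((\<lambda>x. geo_y (f x) (g x)) \<longlongrightarrow> geo_y c s) F"
  unfolding geo_y_def by (intro tendsto_intros tendsto_k1 tendsto_k2 assms)

lemma tendsto_geo_x:
  fixes f g :: "'a::t2_space \<Rightarrow> real"
  assumes "(f \<longlongrightarrow> c) F" "(g \<longlongrightarrow> s) F" "0 < c"
  shows "((\<lambda>x. geo_x (f x) (g x)) \<longlongrightarrow> geo_x c s) F"
  unfolding geo_x_def by (intro tendsto_intros tendsto_k1 tendsto_k2 assms)

text \<open>The sign of \<open>geo_y\<close> at a fixed point beside \<open>s_int c\<close> persists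
  for nearby parameters and keeps \<open>s_int\<close> on the correct side of that point. No
  derivative in \<open>c\<close> enters, so \<open>c = 1\<close> and the endpoint
  \<open>2 / sqrt 3\<close> are covered.\<close>

lemma continuous_on_s_int: "continuous_on {0<..2 / sqrt 3} s_int"
  unfolding continuous_on_def
proof
  fix c :: real assume "c \<in> {0<..2 / sqrt 3}"
  then have c: "0 < c" "c \<le> 2 / sqrt 3" by auto
  let ?F = "at c within {0<..2 / sqrt 3}"
  have dom: "\<forall>\<^sub>F d in ?F. 0 < d \<and> d \<le> 2 / sqrt 3"
    by (auto simp: eventually_at_filter)
  have lim: "((\<lambda>d. geo_y d s) \<longlongrightarrow> geo_y c s) ?F" for s
    by (intro tendsto_geo_y tendsto_intros c)
  show "(s_int \<longlongrightarrow> s_int c) ?F"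
  proof (rule order_tendstoI)
    fix a assume a: "a < s_int c"
    show "\<forall>\<^sub>F d in ?F. a < s_int d"
    proof (cases "0 < a")
      case True
      have "((\<lambda>d. 2 * pi / d) \<longlongrightarrow> 2 * pi / c) ?F" using c by (intro tendsto_intros) auto
      moreover have "a < 2 * pi / c" using a s_int_le[OF c] by linarith
      \<comment> \<open>\<open>geo_y_neg\<close> speaks about \<open>a\<close> only if
        \<open>a <= 2 * pi / d\<close>.\<close>
      ultimately have "\<forall>\<^sub>F d in ?F. a < 2 * pi / d" by (rule order_tendstoD)
      with dom order_tendstoD(1)[OF lim[of a] geo_y_pos[OF c True a]]
      show ?thesis
      proof eventually_elim
        case (elim d)
        then show ?case using geo_y_neg[of d a] geo_y_s_int[of d]
          by (metis less_asym less_imp_le less_irrefl linorder_neqE_linordered_idom)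
      qed
    next
      case False
      from dom show ?thesis by eventually_elim (use False s_int_pos in force)
    qed
  next
    fix b assume b: "s_int c < b"
    show "\<forall>\<^sub>F d in ?F. s_int d < b"
    proof (cases "b \<le> 2 * pi / c")
      case True
      have "0 < b" using b s_int_pos[OF c] by linarith
      from dom order_tendstoD(2)[OF lim[of b] geo_y_neg[OF c b True]]
      show ?thesis
      proof eventually_elim
        case (elim d)
        then show ?case using geo_y_pos[of d b] geo_y_s_int[of d] \<open>0 < b\<close>
          by (metis less_asym less_irrefl linorder_neqE_linordered_idom)
      qed
    next
      case False
      \<comment> \<open>Beyond \<open>2 * pi / c\<close> the sign of \<open>geo_y\<close> is not
        known; the bound \<open>s_int_le\<close> replaces it.\<close>
      have "((\<lambda>d. 2 * pi / d) \<longlongrightarrow> 2 * pi / c) ?F" using c by (intro tendsto_intros) auto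
      then have "\<forall>\<^sub>F d in ?F. 2 * pi / d < b" using False by (intro order_tendstoD) auto
      with dom show ?thesis by eventually_elim (use s_int_le in force)
    qed
  qed
qed

section \<open>Derivatives in the parameter \<open>c\<close>\<close>

lemma DERIV_frequency_less_one:
  fixes c :: real
  assumes "0 < c" "c < 1"
  shows "((\<lambda>c. sqrt (1 - c\<^sup>2)) has_real_derivative - c / sqrt (1 - c\<^sup>2)) (at c)"
proof -
  have "((\<lambda>c. 1 - c\<^sup>2) has_real_derivative - 2 * c) (at c)"
    by (rule derivative_eq_intros refl)+ simp
  from DERIV_chain2[OF DERIV_real_sqrt[OF less_one_imp_pos[OF assms]] this]
  show ?thesis by (simp add: field_simps)
qed

lemma DERIV_frequency_greater_one:
  fixes c :: real
  assumes "1 < c"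
  shows "((\<lambda>c. sqrt (c\<^sup>2 - 1)) has_real_derivative c / sqrt (c\<^sup>2 - 1)) (at c)"
proof -
  have "((\<lambda>c. c\<^sup>2 - 1) has_real_derivative 2 * c) (at c)"
    by (rule derivative_eq_intros refl)+ simp
  from DERIV_chain2[OF DERIV_real_sqrt[OF greater_one_imp_pos[OF assms]] this]
  show ?thesis by (simp add: field_simps)
qed

text \<open>Both branches yield the same formula. The parameter \<open>1\<close> is left out because
  neither frequency is differentiable there.\<close>

lemma DERIV_k1_param:
  assumes "0 < c" "c \<noteq> 1"
  shows "((\<lambda>c. k1 c s) has_real_derivative - s * k2 c s) (at c)"
proof (cases "c < 1")
  case True
  have "((\<lambda>c. cosh (sqrt (1 - c\<^sup>2) * s)) has_real_derivative - s * k2 c s) (at c)"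
    by (rule DERIV_frequency_less_one[OF assms(1) True] DERIV_const derivative_eq_intros refl)+
      (use True in \<open>simp add: k2_def\<close>)
  then show ?thesis
    by (rule has_field_derivative_transform_within_open[of _ _ _ "{..<1}"])
      (use True in \<open>auto simp: k1_def\<close>)
next
  case False
  then have c: "1 < c" using assms by simp
  have "((\<lambda>c. cos (sqrt (c\<^sup>2 - 1) * s)) has_real_derivative - s * k2 c s) (at c)"
    by (rule DERIV_frequency_greater_one[OF c] DERIV_const derivative_eq_intros refl)+
      (use c in \<open>simp add: k2_def\<close>)
  then show ?thesis
    by (rule has_field_derivative_transform_within_open[of _ _ _ "{1<..}"])
      (use c in \<open>auto simp: k1_def\<close>)
qed

lemma DERIV_k2_param:
  assumes "0 < c" "c \<noteq> 1"
  shows "((\<lambda>c. k2 c s) has_real_derivative (k2 c s / c - c\<^sup>2 * s * k1 c s) / (1 - c\<^sup>2)) (at c)"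
proof (cases "c < 1")
  case True
  define w where "w = sqrt (1 - c\<^sup>2)"
  have w: "w > 0" "c\<^sup>2 = 1 - w\<^sup>2" "1 - c\<^sup>2 = w\<^sup>2"
    using less_one_imp_pos[OF assms(1) True] by (auto simp: w_def)
  have e: "k1 c s = cosh (w * s)" "k2 c s = c / w * sinh (w * s)"
    using True by (auto simp: k1_def k2_def w_def)
  have nz: "sqrt (1 - c\<^sup>2) \<noteq> 0" using w(1) by (simp add: w_def)
  note D = nz DERIV_frequency_less_one[OF assms(1) True]
  have "((\<lambda>c. c / sqrt (1 - c\<^sup>2) * sinh (sqrt (1 - c\<^sup>2) * s)) has_real_derivative
      (1 / w + c\<^sup>2 / w ^ 3) * sinh (w * s) - c\<^sup>2 * s / w\<^sup>2 * cosh (w * s)) (at c)"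
    by (rule D DERIV_const derivative_eq_intros refl)+
      (unfold w_def[symmetric],
        use w(1) in \<open>simp add: field_simps power2_eq_square power3_eq_cube\<close>)
  also have "(1 / w + c\<^sup>2 / w ^ 3) * sinh (w * s) - c\<^sup>2 * s / w\<^sup>2 * cosh (w * s) =
      (k2 c s / c - c\<^sup>2 * s * k1 c s) / (1 - c\<^sup>2)"
  proof -
    \<comment> \<open>Over the denominator \<open>w ^ 3\<close> the numerator is
      \<open>w^2 + c^2 = 1\<close>.\<close>
    have "1 / w + c\<^sup>2 / w ^ 3 = 1 / w ^ 3"
      unfolding w(2) using w(1) by (simp add: field_simps power2_eq_square power3_eq_cube)
    then show ?thesis
      unfolding e w(3) using w(1) assms by (simp add: field_simps power2_eq_square power3_eq_cube)
  qed
  finally show ?thesis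
    by (rule has_field_derivative_transform_within_open[of _ _ _ "{..<1}"])
      (use True in \<open>auto simp: k2_def\<close>)
next
  case False
  then have c: "1 < c" using assms by simp
  define w where "w = sqrt (c\<^sup>2 - 1)"
  have w: "w > 0" "c\<^sup>2 = 1 + w\<^sup>2" "1 - c\<^sup>2 = - w\<^sup>2"
    using greater_one_imp_pos[OF c] by (auto simp: w_def)
  have e: "k1 c s = cos (w * s)" "k2 c s = c / w * sin (w * s)"
    using c by (auto simp: k1_def k2_def w_def)
  have nz: "sqrt (c\<^sup>2 - 1) \<noteq> 0" using w(1) by (simp add: w_def)
  note D = nz DERIV_frequency_greater_one[OF c]
  have "((\<lambda>c. c / sqrt (c\<^sup>2 - 1) * sin (sqrt (c\<^sup>2 - 1) * s)) has_real_derivative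
      (1 / w - c\<^sup>2 / w ^ 3) * sin (w * s) + c\<^sup>2 * s / w\<^sup>2 * cos (w * s)) (at c)"
    by (rule D DERIV_const derivative_eq_intros refl)+
      (unfold w_def[symmetric],
        use w(1) in \<open>simp add: field_simps power2_eq_square power3_eq_cube\<close>)
  also have "(1 / w - c\<^sup>2 / w ^ 3) * sin (w * s) + c\<^sup>2 * s / w\<^sup>2 * cos (w * s) =
      (k2 c s / c - c\<^sup>2 * s * k1 c s) / (1 - c\<^sup>2)"
  proof -
    \<comment> \<open>Now \<open>w^2 = c^2 - 1\<close>, so the numerator \<open>w^2 - c^2\<close> is
      \<open>-1\<close>.\<close>
    have eq: "1 / w - c\<^sup>2 / w ^ 3 = - 1 / w ^ 3"
      unfolding w(2) using w(1) by (simp add: field_simps power2_eq_square power3_eq_cube)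
    show ?thesis
      unfolding eq e w(3) using w(1) assms by (simp add: field_simps power2_eq_square power3_eq_cube)
  qed
  finally show ?thesis
    by (rule has_field_derivative_transform_within_open[of _ _ _ "{1<..}"])
      (use c in \<open>auto simp: k2_def\<close>)
qed

text \<open>The value at \<open>c = 1\<close> is the junk value \<open>0\<close>; elsewhere this is the integral of
  \<open>\<sigma> * k2 c \<sigma> / c\<close> over \<open>[0, s]\<close>, which is why it is positive.\<close>

definition param_factor :: "real \<Rightarrow> real \<Rightarrow> real" where
  "param_factor c s = (s * k1 c s - k2 c s / c) / (1 - c\<^sup>2)"

lemma param_factor_pos:
  assumes "0 < c" "c \<noteq> 1" "c \<le> 2 / sqrt 3" "0 < s" "s \<le> 2 * pi / c"
  shows "0 < param_factor c s"
proof -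
  have c2: "1 - c\<^sup>2 \<noteq> 0" using assms by (auto simp: power2_eq_1_iff)
  \<comment> \<open>The two \<open>k1\<close> terms cancel, and the factor \<open>1 - c^2\<close>
    from the derivative of \<open>k1\<close> cancels the denominator.\<close>
  have D: "(param_factor c has_real_derivative t * k2 c t / c) (at t)" for t
  proof -
    have "((\<lambda>s. s * k1 c s - k2 c s / c) has_real_derivative
        t * ((1 - c\<^sup>2) / c * k2 c t)) (at t)"
      by (rule DERIV_cdivide derivative_eq_intros DERIV_k1[OF assms(1)] DERIV_k2[OF assms(1)] refl)+
        (use assms(1) in simp)
    from DERIV_cdivide[OF this, of "1 - c\<^sup>2"]
    have "((\<lambda>s. (s * k1 c s - k2 c s / c) / (1 - c\<^sup>2)) has_real_derivative t * k2 c t / c) (at t)"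
      using c2 by simp
    then show ?thesis by (simp add: param_factor_def[abs_def])
  qed
  have "param_factor c 0 < param_factor c s"
  proof (rule DERIV_pos_imp_increasing_open[OF \<open>0 < s\<close>])
    fix t assume t: "0 < t" "t < s"
    then have "0 < t * k2 c t / c" using k2_pos[of c t] assms by simp
    with D show "\<exists>d. (param_factor c has_real_derivative d) (at t) \<and> 0 < d" by blast
  qed (use D in \<open>meson continuous_at_imp_continuous_on DERIV_isCont\<close>)
  then show ?thesis by (simp add: param_factor_def)
qed

text \<open>The terms with \<open>sin (c * s)\<close> cancel because the \<open>c\<close>-derivative
  of \<open>k1\<close> is \<open>- s * k2\<close>; those with \<open>cos (c * s)\<close> combine to
  \<open>param_factor\<close>.\<close>

lemma DERIV_geo_y_param:
  assumes "0 < c" "c \<noteq> 1"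
  shows "((\<lambda>c. geo_y c s) has_real_derivative cos (c * s) * param_factor c s) (at c)"
proof -
  have c2: "1 - c\<^sup>2 \<noteq> 0" using assms by (auto simp: power2_eq_1_iff)
  have "((\<lambda>c. k1 c s * sin (c * s) - k2 c s * cos (c * s)) has_real_derivative
      cos (c * s) * param_factor c s) (at c)"
    by (rule derivative_eq_intros DERIV_k1_param[OF assms] DERIV_k2_param[OF assms] refl)+
      (use c2 assms in \<open>simp add: param_factor_def field_simps\<close>)
  then show ?thesis by (simp add: geo_y_def)
qed

text \<open>With \<open>DERIV_geo_y_param\<close> this says that varying \<open>c\<close> moves the
  point perpendicularly to the velocity of the curve, whose direction is
  \<open>(cos (c * s), sin (c * s))\<close>.\<close>

lemma DERIV_geo_x_param:
  assumes "0 < c" "c \<noteq> 1"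
  shows "((\<lambda>c. geo_x c s) has_real_derivative - sin (c * s) * param_factor c s) (at c)"
proof -
  have c2: "1 - c\<^sup>2 \<noteq> 0" using assms by (auto simp: power2_eq_1_iff)
  have "((\<lambda>c. k1 c s * cos (c * s) + k2 c s * sin (c * s)) has_real_derivative
      - sin (c * s) * param_factor c s) (at c)"
    by (rule derivative_eq_intros DERIV_k1_param[OF assms] DERIV_k2_param[OF assms] refl)+
      (use c2 assms in \<open>simp add: param_factor_def field_simps\<close>)
  then show ?thesis by (simp add: geo_x_def)
qed

lemma isCont_param_factor:
  assumes "0 < c" "c \<noteq> 1"
  shows "isCont (\<lambda>p. param_factor (fst p) (snd p)) (c, s)"
  unfolding param_factor_def
  by (intro continuous_intros isCont_k1 isCont_k2 assms(1))
    (use assms in \<open>auto simp: power2_eq_1_iff\<close>)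

section \<open>Chain rule and implicit differentiation from partial derivatives\<close>

lemma tendsto_partial_quotient:
  fixes F :: "real \<Rightarrow> real \<Rightarrow> real"
  assumes deriv: "\<forall>\<^sub>F x in nhds x0. \<forall>y. ((\<lambda>x. F x y) has_real_derivative Fx x y) (at x)"
    and cont: "isCont (\<lambda>p. Fx (fst p) (snd p)) (x0, g x0)"
    and g: "isCont g x0"
  shows "((\<lambda>x. (F x (g x) - F x0 (g x)) / (x - x0)) \<longlongrightarrow> Fx x0 (g x0)) (at x0)"
proof -
  obtain e where e: "0 < e"
    "\<And>x y. dist x x0 < e \<Longrightarrow> ((\<lambda>x. F x y) has_real_derivative Fx x y) (at x)"
    using deriv unfolding eventually_nhds_metric by blast
  \<comment> \<open>Mean value theorem in the first argument, with the second frozen at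
    \<open>g x\<close>. Continuity of \<open>Fx\<close> at the single point
    \<open>(x0, g x0)\<close> then gives the limit, although \<open>g x\<close> moves.\<close>
  have "\<exists>\<xi>. \<bar>\<xi> - x0\<bar> \<le> \<bar>x - x0\<bar> \<and> F x (g x) - F x0 (g x) = Fx \<xi> (g x) * (x - x0)"
    if x: "dist x x0 < e" for x
  proof (cases x x0 rule: linorder_cases)
    case less
    obtain z where "x < z" "z < x0" "F x0 (g x) - F x (g x) = (x0 - x) * Fx z (g x)"
      using MVT2[OF less, of "\<lambda>x. F x (g x')" "\<lambda>x. Fx x (g x')" for x', OF e(2)] x
      by (force simp: dist_real_def)
    then show ?thesis by (intro exI[of _ z]) (auto simp: algebra_simps)
  next
    case greater
    obtain z where "x0 < z" "z < x" "F x (g x) - F x0 (g x) = (x - x0) * Fx z (g x)"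
      using MVT2[OF greater, of "\<lambda>x. F x (g x')" "\<lambda>x. Fx x (g x')" for x', OF e(2)] x
      by (force simp: dist_real_def)
    then show ?thesis by (intro exI[of _ z]) (auto simp: algebra_simps)
  qed auto
  then obtain \<xi> where \<xi>: "\<And>x. dist x x0 < e \<Longrightarrow> \<bar>\<xi> x - x0\<bar> \<le> \<bar>x - x0\<bar>"
    "\<And>x. dist x x0 < e \<Longrightarrow> F x (g x) - F x0 (g x) = Fx (\<xi> x) (g x) * (x - x0)"
    by metis
  have near: "\<forall>\<^sub>F x in at x0. dist x x0 < e \<and> x \<noteq> x0"
    using e(1) unfolding eventually_at by blast
  have "((\<lambda>x. \<xi> x - x0) \<longlongrightarrow> 0) (at x0)"
  proof (rule Lim_null_comparison)
    show "\<forall>\<^sub>F x in at x0. norm (\<xi> x - x0) \<le> \<bar>x - x0\<bar>"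
      using near by eventually_elim (use \<xi>(1) in auto)
    show "((\<lambda>x. \<bar>x - x0\<bar>) \<longlongrightarrow> 0) (at x0)" by (rule tendsto_eq_intros refl)+ simp
  qed
  then have "((\<lambda>x. Fx (\<xi> x) (g x)) \<longlongrightarrow> Fx x0 (g x0)) (at x0)"
    using isCont_tendsto_compose[OF cont tendsto_Pair] g
    by (simp add: LIM_zero_iff isCont_def)
  then show ?thesis
    by (rule Lim_transform_eventually) (use near in eventually_elim, use \<xi>(2) in auto)
qed

text \<open>The increment is split at \<open>F x0 (g x)\<close>: the first argument moves with the
  second at \<open>g x\<close>, then the second moves with the first at \<open>x0\<close>.\<close>

lemma DERIV_partial_chain:
  fixes F :: "real \<Rightarrow> real \<Rightarrow> real"
  assumes deriv: "\<forall>\<^sub>F x in nhds x0. \<forall>y. ((\<lambda>x. F x y) has_real_derivative Fx x y) (at x)"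
    and cont: "isCont (\<lambda>p. Fx (fst p) (snd p)) (x0, g x0)"
    and Fy: "(F x0 has_real_derivative Fy) (at (g x0))"
    and g: "(g has_real_derivative g') (at x0)"
  shows "((\<lambda>x. F x (g x)) has_real_derivative Fx x0 (g x0) + Fy * g') (at x0)"
proof -
  have "((\<lambda>x. (F x0 (g x) - F x0 (g x0)) / (x - x0)) \<longlongrightarrow> Fy * g') (at x0)"
    using DERIV_chain2[OF Fy g] by (simp add: has_field_derivative_iff)
  from tendsto_add[OF tendsto_partial_quotient[OF deriv cont DERIV_isCont[OF g]] this]
  show ?thesis by (simp add: has_field_derivative_iff add_divide_distrib diff_divide_distrib)
qed

text \<open>Only the derivative of \<open>g\<close> is sought; \<open>g\<close> is given and
  continuous. Since \<open>F x (g x)\<close> and \<open>F x0 (g x0)\<close> both vanish, the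
  increment of \<open>F\<close> in its first argument is the negative of that in its second.\<close>

lemma DERIV_implicit:
  fixes F :: "real \<Rightarrow> real \<Rightarrow> real"
  assumes deriv: "\<forall>\<^sub>F x in nhds x0. \<forall>y. ((\<lambda>x. F x y) has_real_derivative Fx x y) (at x)"
    and cont: "isCont (\<lambda>p. Fx (fst p) (snd p)) (x0, g x0)"
    and Fy: "(F x0 has_real_derivative Fy) (at (g x0))" "Fy \<noteq> 0"
    and g: "isCont g x0"
    and zero: "\<forall>\<^sub>F x in nhds x0. F x (g x) = 0"
  shows "(g has_real_derivative - Fx x0 (g x0) / Fy) (at x0)"
proof -
  \<comment> \<open>Caratheodory's form of differentiability also holds at points where
    \<open>g x = g x0\<close>, so no case distinction is needed.\<close>
  obtain A where A: "\<And>y. F x0 y - F x0 (g x0) = A y * (y - g x0)" "isCont A (g x0)" "A (g x0) = Fy"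
    using Fy(1) unfolding CARAT_DERIV by blast
  have lim: "((\<lambda>x. A (g x)) \<longlongrightarrow> Fy) (at x0)"
    using isCont_o2[OF g A(2)] A(3) by (simp add: isCont_def)
  have "((\<lambda>x. - ((F x (g x) - F x0 (g x)) / (x - x0)) / A (g x)) \<longlongrightarrow> - Fx x0 (g x0) / Fy) (at x0)"
    by (intro tendsto_intros tendsto_partial_quotient deriv cont g lim Fy(2))
  moreover have "\<forall>\<^sub>F x in at x0. - ((F x (g x) - F x0 (g x)) / (x - x0)) / A (g x) =
      (g x - g x0) / (x - x0)"
  proof -
    have z0: "F x0 (g x0) = 0" using zero by (rule eventually_nhds_x_imp_x)
    have "\<forall>\<^sub>F x in at x0. F x (g x) = 0" using zero by (simp add: eventually_at_filter eventually_mono)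
    \<comment> \<open>\<open>A (g x)\<close> tends to the nonzero \<open>Fy\<close>, hence can
      eventually be divided out.\<close>
    with tendsto_imp_eventually_ne[OF lim Fy(2)] show ?thesis
    proof eventually_elim
      case (elim x)
      then show ?case using A(1)[of "g x"] z0 by simp
    qed
  qed
  ultimately show ?thesis unfolding has_field_derivative_iff by (rule Lim_transform_eventually)
qed

section \<open>Derivatives of \<open>s_int\<close> and \<open>x_int\<close> for
  \<open>c < 2 / sqrt 3\<close>\<close>

context
  fixes c :: real
  assumes c: "0 < c" "c < 2 / sqrt 3"
begin

private lemma c_le: "c \<le> 2 / sqrt 3"
  using c by simp

lemma frequency_less_half: "sqrt (c\<^sup>2 - 1) < c / 2"
proof -
  have "c\<^sup>2 < (2 / sqrt 3)\<^sup>2" using c by (intro power_strict_mono) auto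
  then have "c\<^sup>2 - 1 < (c / 2)\<^sup>2" by (simp add: power_divide)
  then show ?thesis using c by (intro real_less_lsqrt) auto
qed

text \<open>Below \<open>2 / sqrt 3\<close> the function \<open>k2\<close> is still positive at
  \<open>2 * pi / c\<close>, where \<open>geo_y\<close> equals \<open>- k2\<close>. Strictness keeps
  \<open>sin (c * s_int c)\<close> and \<open>k2\<close> nonzero, as implicit differentiation
  requires.\<close>

lemma s_int_less: "s_int c < 2 * pi / c"
proof -
  have "0 < k2 c (2 * pi / c)"
  proof (cases "1 < c")
    case True
    have "sqrt (c\<^sup>2 - 1) * (2 * pi / c) < c / 2 * (2 * pi / c)"
      using frequency_less_half c by (intro mult_strict_right_mono) auto
    also have "\<dots> = pi" using c by simp
    finally have "0 < sin (sqrt (c\<^sup>2 - 1) * (2 * pi / c))"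
      using greater_one_imp_pos[OF True] c by (intro sin_gt_zero) auto
    then show ?thesis using greater_one_imp_pos[OF True] True by (simp add: k2_def)
  next
    case False
    then show ?thesis using less_one_imp_pos[OF c(1)] c
      by (cases "c = 1") (auto simp: k2_def)
  qed
  then have "geo_y c (2 * pi / c) < 0" using c by (simp add: geo_y_def)
  then show ?thesis using s_int_le[OF c(1) c_le] geo_y_s_int[OF c(1) c_le]
    by (metis less_irrefl order_le_less)
qed

lemma sin_s_int_neg: "sin (c * s_int c) < 0"
  using s_int_gt[OF c(1) c_le] s_int_less c by (intro sin_lt_zero) (auto simp: field_simps)

lemma k2_s_int_pos: "0 < k2 c (s_int c)"
  using k2_pos[OF c(1) c_le s_int_pos[OF c(1) c_le] s_int_less] .

lemma DERIV_s_int: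
  assumes "c \<noteq> 1"
  shows "(s_int has_real_derivative
    - (cos (c * s_int c) * param_factor c (s_int c)) / (k2 c (s_int c) * sin (c * s_int c) / c)) (at c)"
proof (rule DERIV_implicit[where F = geo_y and Fx = "\<lambda>c s. cos (c * s) * param_factor c s"])
  have dom: "\<forall>\<^sub>F x in nhds c. x \<in> {0<..<2 / sqrt 3} - {1}"
    using c assms by (intro eventually_nhds_in_open) (auto intro!: open_Diff)
  then show "\<forall>\<^sub>F x in nhds c. \<forall>s. ((\<lambda>x. geo_y x s) has_real_derivative
      cos (x * s) * param_factor x s) (at x)"
    by eventually_elim (auto intro!: DERIV_geo_y_param)
  from dom show "\<forall>\<^sub>F x in nhds c. geo_y x (s_int x) = 0"
    by eventually_elim (auto intro!: geo_y_s_int)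
  show "isCont s_int c"
    using continuous_on_interior[OF continuous_on_s_int, of c] c by simp
  show "isCont (\<lambda>p. cos (fst p * snd p) * param_factor (fst p) (snd p)) (c, s_int c)"
    
      by (intro continuous_intros isCont_param_factor c assms)
  show "(geo_y c has_real_derivative k2 c (s_int c) * sin (c * s_int c) / c) (at (s_int c))"
    by (rule DERIV_geo_y[OF c(1)])
  show "k2 c (s_int c) * sin (c * s_int c) / c \<noteq> 0"
    using k2_s_int_pos sin_s_int_neg c by simp
qed

lemma DERIV_x_int:
  assumes "c \<noteq> 1"
  shows "(x_int has_real_derivative - (param_factor c (s_int c) / sin (c * s_int c))) (at c)"
proof -
  let ?E = "param_factor c (s_int c)" and ?S = "sin (c * s_int c)" and ?C = "cos (c * s_int c)"
    and ?k = "k2 c (s_int c)"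
  have "((\<lambda>c. geo_x c (s_int c)) has_real_derivative
      - ?S * ?E + (?k * ?C / c) * (- (?C * ?E) / (?k * ?S / c))) (at c)"
  proof (rule DERIV_partial_chain[where F = geo_x and g = s_int
        and Fx = "\<lambda>c s. - sin (c * s) * param_factor c s"])
    have "\<forall>\<^sub>F x in nhds c. x \<in> {0<..} - {1}"
      using c assms by (intro eventually_nhds_in_open) (auto intro!: open_Diff)
    then show "\<forall>\<^sub>F x in nhds c. \<forall>s. ((\<lambda>x. geo_x x s) has_real_derivative
        - sin (x * s) * param_factor x s) (at x)"
      by eventually_elim (use DERIV_geo_x_param in auto)
    show "isCont (\<lambda>p. - sin (fst p * snd p) * param_factor (fst p) (snd p)) (c, s_int c)"
      
      by (intro continuous_intros isCont_param_factor c assms)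
    show "(s_int has_real_derivative - (?C * ?E) / (?k * ?S / c)) (at c)"
      by (rule DERIV_s_int[OF assms])
  qed (rule DERIV_geo_x[OF c(1)])
  moreover have "- ?S * ?E + (?k * ?C / c) * (- (?C * ?E) / (?k * ?S / c)) = - (?E / ?S)"
  proof -
    \<comment> \<open>For independent reals \<open>S\<close> and \<open>C\<close> the sum carries
      the factor \<open>S^2 + C^2\<close>, which becomes \<open>1\<close> for the sine and
      cosine.\<close>
    have "- S * E + (k * C / c) * (- (C * E) / (k * S / c)) = - (E * (S\<^sup>2 + C\<^sup>2)) / S"
      if "S \<noteq> 0" "k \<noteq> 0" "c \<noteq> 0" for S C E k c :: real
      using that by (simp add: field_simps power2_eq_square)
    from this[of ?S ?k c ?E ?C]
    have "- ?S * ?E + (?k * ?C / c) * (- (?C * ?E) / (?k * ?S / c)) = - (?E * (?S\<^sup>2 + ?C\<^sup>2)) / ?S"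
      using sin_s_int_neg k2_s_int_pos c by simp
    then show ?thesis by simp
  qed
  ultimately show ?thesis by (simp add: x_int_def[abs_def])
qed

lemma param_factor_s_int_pos:
  assumes "c \<noteq> 1" shows "0 < param_factor c (s_int c)"
  using param_factor_pos[OF c(1) assms c_le s_int_pos[OF c(1) c_le] s_int_le[OF c(1) c_le]] .

end

section \<open>Sign and absolute value of \<open>x_int\<close>\<close>

lemma k1_k2_s_int:
  assumes "0 < c" "c \<le> 2 / sqrt 3"
  shows "k1 c (s_int c) = x_int c * cos (c * s_int c)"
    and "k2 c (s_int c) = x_int c * sin (c * s_int c)"
proof -
  let ?S = "sin (c * s_int c)" and ?C = "cos (c * s_int c)"
  \<comment> \<open>\<open>(k1, k2)\<close> is mapped to \<open>(geo_x, geo_y)\<close> by the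
    reflection with rows \<open>(cos, sin)\<close> and \<open>(sin, - cos)\<close>. It is its own
    inverse, so it sends \<open>(x_int c, 0)\<close> back to \<open>(k1, k2)\<close>.\<close>
  have y: "k1 c (s_int c) * ?S = k2 c (s_int c) * ?C"
    using geo_y_s_int[OF assms] by (simp add: geo_y_def)
  have x: "x_int c = k1 c (s_int c) * ?C + k2 c (s_int c) * ?S"
    by (simp add: x_int_def geo_x_def)
  have "x_int c * ?C = k1 c (s_int c) * (?S\<^sup>2 + ?C\<^sup>2)"
    unfolding x using y by algebra
  then show "k1 c (s_int c) = x_int c * ?C" by simp
  have "x_int c * ?S = k2 c (s_int c) * (?S\<^sup>2 + ?C\<^sup>2)"
    unfolding x using y by algebra
  then show "k2 c (s_int c) = x_int c * ?S" by simp
qed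

text \<open>The reflection preserves the Euclidean norm.\<close>

lemma abs_x_int:
  assumes "0 < c" "c \<le> 2 / sqrt 3"
  shows "\<bar>x_int c\<bar> = sqrt ((k1 c (s_int c))\<^sup>2 + (k2 c (s_int c))\<^sup>2)"
proof -
  have "(k1 c (s_int c))\<^sup>2 + (k2 c (s_int c))\<^sup>2 = (x_int c)\<^sup>2"
    unfolding k1_k2_s_int[OF assms] power_mult_distrib by (simp flip: distrib_left)
  then show ?thesis by simp
qed

lemma x_int_neg:
  assumes "0 < c" "c < 2 / sqrt 3"
  shows "x_int c < 0"
  using k1_k2_s_int(2)[of c] k2_s_int_pos[of c] sin_s_int_neg[of c] assms
  by (auto simp: zero_less_mult_iff)


lemma continuous_on_x_int: "continuous_on {0<..2 / sqrt 3} x_int"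
  unfolding x_int_def[abs_def] continuous_on_def
  using continuous_on_s_int by (auto simp: continuous_on_def intro!: tendsto_geo_x tendsto_intros)

section \<open>Position of \<open>s_int c\<close> relative to \<open>3 * pi / (2 * c)\<close>, and
  exact values\<close>

lemma critical_param_bounds:
  "1 < 3 / (2 * sqrt 2)" "3 / (2 * sqrt 2) < 2 / sqrt 3" "(1 :: real) < 2 / sqrt 3"
proof -
  \<comment> \<open>The squares compared are \<open>1 < 9 / 8 < 4 / 3\<close>.\<close>
  have "1\<^sup>2 < (3 / (2 * sqrt 2))\<^sup>2" by (simp add: power_divide power_mult_distrib)
  then show a: "1 < 3 / (2 * sqrt 2)" by (rule power2_less_imp_less) simp
  have "(3 / (2 * sqrt 2))\<^sup>2 < (2 / sqrt 3)\<^sup>2" by (simp add: power_divide power_mult_distrib)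
  then show b: "3 / (2 * sqrt 2) < 2 / sqrt 3" by (rule power2_less_imp_less) simp
  from a b show "(1 :: real) < 2 / sqrt 3" by linarith
qed

text \<open>This reduces the comparison of \<open>s_int c\<close> with
  \<open>3 * pi / (2 * c)\<close> to the sign of \<open>k1\<close>.\<close>

lemma geo_y_three_halves_pi:
  assumes "0 < c"
  shows "geo_y c (3 * pi / (2 * c)) = - k1 c (3 * pi / (2 * c))"
proof -
  have "c * (3 * pi / (2 * c)) = pi + pi / 2" using assms by (simp add: field_simps)
  then show ?thesis unfolding geo_y_def by (simp only: sin_add cos_add) simp
qed

lemma three_halves_pi_le:
  fixes c :: real assumes "0 < c" shows "0 < 3 * pi / (2 * c)" "3 * pi / (2 * c) \<le> 2 * pi / c"
  using assms by (auto simp: field_simps)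

lemma s_int_less_three_halves_pi:
  assumes "0 < c" "c < 3 / (2 * sqrt 2)"
  shows "s_int c < 3 * pi / (2 * c)"
proof -
  have c: "c \<le> 2 / sqrt 3" using assms critical_param_bounds by linarith
  have "0 < k1 c (3 * pi / (2 * c))"
  proof (cases "1 < c")
    case True
    have "c\<^sup>2 < (3 / (2 * sqrt 2))\<^sup>2" using assms by (intro power_strict_mono) auto
    \<comment> \<open>\<open>c^2 < 9 / 8\<close> is the same as \<open>c^2 - 1 < c^2 / 9\<close>:
      the frequency is below \<open>c / 3\<close>, so the argument of \<open>k1\<close> is below
      \<open>pi / 2\<close>.\<close>
    then have "c\<^sup>2 - 1 < (c / 3)\<^sup>2" by (simp add: power_divide power_mult_distrib)
    then have "sqrt (c\<^sup>2 - 1) < c / 3" using assms by (intro real_less_lsqrt) auto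
    then have "sqrt (c\<^sup>2 - 1) * (3 * pi / (2 * c)) < c / 3 * (3 * pi / (2 * c))"
      using assms by (intro mult_strict_right_mono) auto
    also have "\<dots> = pi / 2" using assms by simp
    finally show ?thesis
      using True assms by (auto simp: k1_def intro!: cos_gt_zero greater_one_imp_pos)
  qed (simp add: k1_def)
  then have "geo_y c (3 * pi / (2 * c)) < 0" using geo_y_three_halves_pi[OF assms(1)] by simp
  then show ?thesis
    using geo_y_pos[OF assms(1) c three_halves_pi_le(1)[OF assms(1)]] geo_y_s_int[OF assms(1) c]
    by (metis less_asym less_irrefl linorder_neqE_linordered_idom)
qed

lemma s_int_greater_three_halves_pi:
  assumes "3 / (2 * sqrt 2) < c" "c \<le> 2 / sqrt 3"
  shows "3 * pi / (2 * c) < s_int c"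
proof -
  have c: "1 < c" "0 < c" using assms critical_param_bounds by linarith+
  have "(3 / (2 * sqrt 2))\<^sup>2 < c\<^sup>2" using assms by (intro power_strict_mono) auto
  then have "(c / 3)\<^sup>2 < c\<^sup>2 - 1" by (simp add: power_divide power_mult_distrib)
  then have "c / 3 < sqrt (c\<^sup>2 - 1)" by (rule real_less_rsqrt)
  then have "c / 3 * (3 * pi / (2 * c)) < sqrt (c\<^sup>2 - 1) * (3 * pi / (2 * c))"
    using c by (intro mult_strict_right_mono) auto
  then have "pi / 2 < sqrt (c\<^sup>2 - 1) * (3 * pi / (2 * c))" using c by simp
  \<comment> \<open>The bound \<open>c / 2\<close> on the frequency keeps the argument at most
    \<open>3 * pi / 4\<close>, so the cosine does not become positive again.\<close>
  moreover have "sqrt (c\<^sup>2 - 1) * (3 * pi / (2 * c)) \<le> c / 2 * (3 * pi / (2 * c))"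
    using c by (intro mult_right_mono frequency_le_half assms) auto
  moreover have "c / 2 * (3 * pi / (2 * c)) < pi" using c by simp
  ultimately have "0 < cos (pi - sqrt (c\<^sup>2 - 1) * (3 * pi / (2 * c)))"
    by (intro cos_gt_zero) linarith+
  then have "k1 c (3 * pi / (2 * c)) < 0" using c by (simp add: k1_def)
  then have "0 < geo_y c (3 * pi / (2 * c))" using geo_y_three_halves_pi[OF c(2)] by simp
  then show ?thesis
    using geo_y_neg[OF c(2) assms(2) _ three_halves_pi_le(2)[OF c(2)]] geo_y_s_int[OF c(2) assms(2)]
    by (metis less_asym less_irrefl linorder_neqE_linordered_idom)
qed

text \<open>At this parameter the frequency is exactly \<open>c / 3\<close>, so \<open>k1\<close>
  and with it \<open>geo_y\<close> vanish at \<open>3 * pi / (2 * c)\<close>.\<close>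

lemma s_int_critical: "s_int (3 / (2 * sqrt 2)) = pi * sqrt 2"
proof -
  define c :: real where "c = 3 / (2 * sqrt 2)"
  have c: "1 < c" "0 < c" "c \<le> 2 / sqrt 3" using critical_param_bounds by (auto simp: c_def)
  have s: "3 * pi / (2 * c) = pi * sqrt 2" by (simp add: c_def field_simps)
  have "c\<^sup>2 - 1 = (c / 3)\<^sup>2" by (simp add: c_def power_divide power_mult_distrib)
  then have w: "sqrt (c\<^sup>2 - 1) = c / 3" using c by (simp add: real_sqrt_unique)
  have "sqrt (c\<^sup>2 - 1) * (3 * pi / (2 * c)) = pi / 2" unfolding w using c by simp
  moreover have "k1 c (3 * pi / (2 * c)) = cos (sqrt (c\<^sup>2 - 1) * (3 * pi / (2 * c)))"
    using c unfolding k1_def by simp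
  ultimately have "k1 c (3 * pi / (2 * c)) = 0" by (simp only: cos_pi_half)
  then have "geo_y c (3 * pi / (2 * c)) = 0" using geo_y_three_halves_pi[OF c(2)] by simp
  from s_int_unique[OF c(2,3) three_halves_pi_le[OF c(2)] this] show ?thesis
    unfolding s by (simp add: c_def)
qed

lemma
  fixes e :: real
  defines "e \<equiv> 2 / sqrt 3"
  shows s_int_endpoint: "s_int e = sqrt 3 * pi"
    and abs_x_int_endpoint: "\<bar>x_int e\<bar> = 1"
proof -
  have e: "1 < e" "0 < e" "e \<le> 2 / sqrt 3" using critical_param_bounds by (auto simp: e_def)
  have s: "2 * pi / e = sqrt 3 * pi" by (simp add: e_def field_simps)
  \<comment> \<open>The frequency is exactly \<open>e / 2\<close>, so the zero lies at the right end
    \<open>2 * pi / e\<close> of the interval of uniqueness.\<close>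
  have "e\<^sup>2 - 1 = (e / 2)\<^sup>2" by (simp add: e_def power_divide)
  then have w: "sqrt (e\<^sup>2 - 1) = e / 2" using e by (simp add: real_sqrt_unique)
  have "sqrt (e\<^sup>2 - 1) * (2 * pi / e) = pi" unfolding w using e by simp
  then have k: "k1 e (2 * pi / e) = -1" "k2 e (2 * pi / e) = 0"
    using e by (simp_all add: k1_def k2_def)
  then have "geo_y e (2 * pi / e) = 0" using e by (simp add: geo_y_def)
  then have "2 * pi / e = s_int e" using s_int_unique[OF e(2,3)] e by simp
  then show "s_int e = sqrt 3 * pi" "\<bar>x_int e\<bar> = 1"
    using s k abs_x_int[OF e(2,3)] by auto
qed

section \<open>Signs of the derivatives and monotonicity\<close>

lemma cos_neg_third_quadrant: "cos x < 0" if "pi < x" "x < 3 * pi / 2" for x :: real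
proof -
  have "0 < cos (x - pi)" using that by (intro cos_gt_zero) auto
  then show ?thesis by simp
qed

lemma cos_s_int_neg:
  assumes "0 < c" "c < 3 / (2 * sqrt 2)"
  shows "cos (c * s_int c) < 0"
proof (rule cos_neg_third_quadrant)
  have "c \<le> 2 / sqrt 3" using assms critical_param_bounds by linarith
  from s_int_gt[OF assms(1) this] show "pi < c * s_int c"
    using assms by (simp add: field_simps)
  show "c * s_int c < 3 * pi / 2"
    using s_int_less_three_halves_pi[OF assms] assms by (simp add: field_simps)
qed

lemma cos_s_int_pos:
  assumes "3 / (2 * sqrt 2) < c" "c < 2 / sqrt 3"
  shows "0 < cos (c * s_int c)"
proof -
  have c: "0 < c" using assms critical_param_bounds by linarith
  have "3 * pi / 2 < c * s_int c"
    using s_int_greater_three_halves_pi[of c] assms c by (simp add: field_simps)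
  moreover have "c * s_int c < 2 * pi"
    using s_int_less[OF c assms(2)] c by (simp add: field_simps)
  ultimately have "0 < cos (2 * pi - c * s_int c)" by (intro cos_gt_zero) linarith+
  then show ?thesis by (simp add: cos_diff)
qed

lemma strict_antimono_on_if_DERIV_neg:
  fixes f :: "real \<Rightarrow> real"
  assumes "\<And>x. a < x \<Longrightarrow> x < b \<Longrightarrow> \<exists>d. (f has_real_derivative d) (at x) \<and> d < 0"
  shows "strict_antimono_on {a<..<b} f"
proof (rule monotone_onI)
  fix x y assume xy: "x \<in> {a<..<b}" "y \<in> {a<..<b}" "x < y"
  show "f y < f x"
  proof (rule DERIV_neg_imp_decreasing[OF \<open>x < y\<close>])
    fix z assume "x \<le> z" "z \<le> y"
    with xy have "a < z" "z < b" by auto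
    then show "\<exists>d. (f has_real_derivative d) (at z) \<and> d < 0" by (rule assms)
  qed
qed

lemma strict_mono_on_if_DERIV_pos:
  fixes f :: "real \<Rightarrow> real"
  assumes "\<And>x. a < x \<Longrightarrow> x < b \<Longrightarrow> \<exists>d. (f has_real_derivative d) (at x) \<and> 0 < d"
  shows "strict_mono_on {a<..<b} f"
proof (rule monotone_onI)
  fix x y assume xy: "x \<in> {a<..<b}" "y \<in> {a<..<b}" "x < y"
  show "f x < f y"
  proof (rule DERIV_pos_imp_increasing[OF \<open>x < y\<close>])
    fix z assume "x \<le> z" "z \<le> y"
    with xy have "a < z" "z < b" by auto
    then show "\<exists>d. (f has_real_derivative d) (at z) \<and> 0 < d" by (rule assms)
  qed
qed

text \<open>The numerator is positive by \<open>cos_s_int_neg\<close>; the denominator is negative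
  because \<open>k2\<close> is positive and the sine negative.\<close>

lemma DERIV_s_int_neg:
  assumes "0 < c" "c \<noteq> 1" "c < 3 / (2 * sqrt 2)"
  shows "\<exists>d. (s_int has_real_derivative d) (at c) \<and> d < 0"
proof (intro exI conjI)
  have c: "c < 2 / sqrt 3" using assms critical_param_bounds by linarith
  show "(s_int has_real_derivative - (cos (c * s_int c) * param_factor c (s_int c)) /
      (k2 c (s_int c) * sin (c * s_int c) / c)) (at c)"
    by (rule DERIV_s_int[OF assms(1) c assms(2)])
  show "- (cos (c * s_int c) * param_factor c (s_int c)) /
      (k2 c (s_int c) * sin (c * s_int c) / c) < 0"
    using mult_neg_pos[OF cos_s_int_neg[OF assms(1,3)] param_factor_s_int_pos[OF assms(1) c assms(2)]]
      mult_pos_neg[OF k2_s_int_pos[OF assms(1) c] sin_s_int_neg[OF assms(1) c]] assms(1)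
    by (intro divide_pos_neg divide_neg_pos) auto
qed

text \<open>Past the critical parameter only the cosine has changed sign.\<close>

lemma DERIV_s_int_pos:
  assumes "3 / (2 * sqrt 2) < c" "c < 2 / sqrt 3"
  shows "\<exists>d. (s_int has_real_derivative d) (at c) \<and> 0 < d"
proof (intro exI conjI)
  have c: "0 < c" "c \<noteq> 1" using assms critical_param_bounds by linarith+
  show "(s_int has_real_derivative - (cos (c * s_int c) * param_factor c (s_int c)) /
      (k2 c (s_int c) * sin (c * s_int c) / c)) (at c)"
    by (rule DERIV_s_int[OF c(1) assms(2) c(2)])
  show "0 < - (cos (c * s_int c) * param_factor c (s_int c)) /
      (k2 c (s_int c) * sin (c * s_int c) / c)"
    using mult_pos_pos[OF cos_s_int_pos[OF assms] param_factor_s_int_pos[OF c(1) assms(2) c(2)]]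
      mult_pos_neg[OF k2_s_int_pos[OF c(1) assms(2)] sin_s_int_neg[OF c(1) assms(2)]] c(1)
    by (intro divide_neg_neg divide_neg_pos) auto
qed

text \<open>\<open>x_int\<close> increases and is negative. The point \<open>1\<close> is excluded
  because \<open>DERIV_x_int\<close> is restricted to other parameters.\<close>

lemma strict_antimono_on_abs_x_int:
  assumes "0 \<le> a" "b \<le> 2 / sqrt 3" "1 \<notin> {a<..<b}"
  shows "strict_antimono_on {a<..<b} (\<lambda>c. \<bar>x_int c\<bar>)"
proof -
  have "strict_mono_on {a<..<b} x_int"
  proof (rule strict_mono_on_if_DERIV_pos)
    fix c assume "a < c" "c < b"
    then have c: "0 < c" "c < 2 / sqrt 3" "c \<noteq> 1" using assms by auto
    have "0 < - (param_factor c (s_int c) / sin (c * s_int c))"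
      using param_factor_s_int_pos[OF c] sin_s_int_neg[OF c(1,2)] by (simp add: divide_pos_neg)
    with DERIV_x_int[OF c] show "\<exists>d. (x_int has_real_derivative d) (at c) \<and> 0 < d" by blast
  qed
  then have mono: "x_int c < x_int d" if "c \<in> {a<..<b}" "d \<in> {a<..<b}" "c < d" for c d
    using that by (rule monotone_onD)
  show ?thesis
  proof (rule monotone_onI)
    fix c d assume cd: "c \<in> {a<..<b}" "d \<in> {a<..<b}" "c < d"
    then have "x_int d < 0" using assms by (intro x_int_neg) auto
    with mono[OF cd] show "\<bar>x_int d\<bar> < \<bar>x_int c\<bar>" by simp
  qed
qed

section \<open>The parameter \<open>c = 1\<close> and \<open>s_bar\<close>\<close>

lemma tan_eq_self_iff:
  assumes "s \<in> {pi<..<3 * pi / 2}"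
  shows "tan s = s \<longleftrightarrow> s = s_int 1"
proof -
  have "cos s \<noteq> 0" using cos_neg_third_quadrant[of s] assms by force
  \<comment> \<open>At \<open>c = 1\<close> the function \<open>geo_y\<close> is
    \<open>sin s - s * cos s\<close>.\<close>
  then have "tan s = s \<longleftrightarrow> geo_y 1 s = 0"
    by (auto simp: tan_def geo_y_def k1_def k2_def field_simps)
  also have "\<dots> \<longleftrightarrow> s = s_int 1"
  proof
    assume "geo_y 1 s = 0"
    then show "s = s_int 1"
      using assms critical_param_bounds pi_gt_zero by (intro s_int_unique) auto
  qed (use critical_param_bounds geo_y_s_int[of 1] in auto)
  finally show ?thesis .
qed

lemma s_int_one_mem: "s_int 1 \<in> {pi<..<3 * pi / 2}"
  using s_int_gt[of 1] s_int_less_three_halves_pi[of 1] critical_param_bounds by simp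

lemma ex1_tan_eq_self: "\<exists>!s. s \<in> {pi<..<3 * pi / 2} \<and> tan s = s"
  using tan_eq_self_iff s_int_one_mem by metis

lemma s_bar_eq: "s_bar = s_int 1"
  unfolding s_bar_def using tan_eq_self_iff s_int_one_mem by (intro the_equality) auto

lemma abs_x_int_one: "\<bar>x_int 1\<bar> = sqrt (1 + s_bar\<^sup>2)"
  using abs_x_int[of 1] critical_param_bounds by (simp add: s_bar_eq k1_def k2_def)

section \<open>Limits at \<open>1\<close>, at \<open>2 / sqrt 3\<close> and at
  \<open>0\<close>\<close>

lemma tendsto_at_one:
  assumes "continuous_on {0<..2 / sqrt 3} f"
  shows "(f \<longlongrightarrow> f 1) (at_left 1)" "(f \<longlongrightarrow> f 1) (at_right 1)"
proof -
  have "isCont f 1"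
    using continuous_on_interior[OF assms, of 1] critical_param_bounds by simp
  then show "(f \<longlongrightarrow> f 1) (at_left 1)" "(f \<longlongrightarrow> f 1) (at_right 1)"
    by (simp_all add: isCont_def filterlim_at_split)
qed

lemma tendsto_at_endpoint:
  assumes "continuous_on {0<..2 / sqrt 3} f"
  shows "(f \<longlongrightarrow> f (2 / sqrt 3)) (at_left (2 / sqrt 3))"
proof -
  have "(f \<longlongrightarrow> f (2 / sqrt 3)) (at (2 / sqrt 3) within {0<..2 / sqrt 3})"
    using assms by (simp add: continuous_on_def)
  \<comment> \<open>On a closed interval, the limit within it at its right end is the left
    limit.\<close>
  then have "(f \<longlongrightarrow> f (2 / sqrt 3)) (at (2 / sqrt 3) within {1..2 / sqrt 3})"
    by (rule tendsto_within_subset) auto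
  then show ?thesis using critical_param_bounds by (simp add: at_within_Icc_at_left)
qed

lemma filterlim_s_int_at_right_0: "filterlim s_int at_top (at_right 0)"
proof (rule filterlim_at_top_mono)
  show "filterlim (\<lambda>c. pi / c) at_top (at_right 0)"
    unfolding divide_inverse
    by (rule filterlim_tendsto_pos_mult_at_top[OF tendsto_const pi_gt_zero
          filterlim_inverse_at_top_right])
  have "\<forall>\<^sub>F c in at_right 0. c \<in> {0<..<(1::real)}" by (rule eventually_at_right_real) simp
  then show "\<forall>\<^sub>F c in at_right 0. pi / c \<le> s_int c"
  proof eventually_elim
    case (elim c)
    then have "0 < c" "c \<le> 2 / sqrt 3" using critical_param_bounds(3) by (simp_all only: greaterThanLessThan_iff) linarith
    then show ?case using s_int_gt less_imp_le by blast
  qed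
qed

text \<open>\<open>\<bar>x_int c\<bar>\<close> dominates \<open>k1\<close>, here a hyperbolic
  cosine. The crude bound \<open>x / 2 \<le> cosh x\<close> suffices, as the frequency tends to
  \<open>1\<close> and \<open>s_int\<close> to infinity.\<close>

lemma filterlim_abs_x_int_at_right_0: "filterlim (\<lambda>c. \<bar>x_int c\<bar>) at_top (at_right 0)"
proof (rule filterlim_at_top_mono)
  have "((\<lambda>c::real. sqrt (1 - c\<^sup>2) / 2) \<longlongrightarrow> 1 / 2) (at_right 0)"
    by (rule tendsto_eq_intros refl)+ simp_all
  then show "filterlim (\<lambda>c. sqrt (1 - c\<^sup>2) / 2 * s_int c) at_top (at_right 0)"
    by (rule filterlim_tendsto_pos_mult_at_top[OF _ _ filterlim_s_int_at_right_0]) simp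
  have "\<forall>\<^sub>F c in at_right 0. c \<in> {0<..<(1::real)}" by (rule eventually_at_right_real) simp
  then show "\<forall>\<^sub>F c in at_right 0. sqrt (1 - c\<^sup>2) / 2 * s_int c \<le> \<bar>x_int c\<bar>"
  proof eventually_elim
    case (elim c)
    then have c: "0 < c" "c < 1" "c \<le> 2 / sqrt 3" using critical_param_bounds(3) by (simp_all only: greaterThanLessThan_iff) linarith
    have "x / 2 \<le> cosh x" for x :: real
    proof -
      have "x \<le> exp x + exp (- x)"
        using exp_ge_add_one_self[of x] exp_gt_zero[of "- x"] by linarith
      then show ?thesis by (simp add: cosh_def)
    qed
    then have "sqrt (1 - c\<^sup>2) / 2 * s_int c \<le> k1 c (s_int c)"
      using c by (simp add: k1_def)
    also have "\<dots> \<le> \<bar>x_int c\<bar>"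
      unfolding abs_x_int[OF c(1,3)] by (rule real_le_rsqrt) simp
    finally show ?case .
  qed
qed

text \<open>The first two conjuncts provide the least zero and the unique solution, so that
  \<open>s_int\<close> on \<open>(0, 2 / sqrt 3]\<close> and \<open>s_bar\<close> have their
  intended values.\<close>

theorem mainTheorem3:
  shows
    "(\<forall>c\<in>{0<..2 / sqrt 3}. 0 < s_int c \<and> geo_y c (s_int c) = 0 \<and>
        (\<forall>s. 0 < s \<and> geo_y c s = 0 \<longrightarrow> s_int c \<le> s)) \<and>
     (\<exists>!s. s \<in> {pi<..<3 * pi / 2} \<and> tan s = s) \<and>
     ((\<forall>c\<in>{0<..<1}. pi / c < s_int c \<and> s_int c < 3 * pi / (2 * c)) \<and>
     s_int differentiable_on {0<..<1} \<and>
     strict_antimono_on {0<..<1} s_int \<and>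
     filterlim s_int at_top (at_right 0) \<and>
     (s_int \<longlongrightarrow> s_bar) (at_left 1) \<and>
     (\<forall>c\<in>{0<..<1}. x_int c < 0) \<and>
     strict_antimono_on {0<..<1} (\<lambda>c. \<bar>x_int c\<bar>) \<and>
     filterlim (\<lambda>c. \<bar>x_int c\<bar>) at_top (at_right 0) \<and>
     ((\<lambda>c. \<bar>x_int c\<bar>) \<longlongrightarrow> sqrt (1 + s_bar\<^sup>2)) (at_left 1)) \<and>
     (continuous_on {1<..<2 / sqrt 3} s_int \<and>
     strict_antimono_on {1<..<3 / (2 * sqrt 2)} s_int \<and>
     strict_mono_on {3 / (2 * sqrt 2)<..<2 / sqrt 3} s_int \<and>
     s_int (3 / (2 * sqrt 2)) = pi * sqrt 2 \<and>
     (s_int \<longlongrightarrow> s_bar) (at_right 1) \<and>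
     (s_int \<longlongrightarrow> sqrt 3 * pi) (at_left (2 / sqrt 3)) \<and>
     strict_antimono_on {1<..<2 / sqrt 3} (\<lambda>c. \<bar>x_int c\<bar>) \<and>
     ((\<lambda>c. \<bar>x_int c\<bar>) \<longlongrightarrow> sqrt (1 + s_bar\<^sup>2)) (at_right 1) \<and>
     ((\<lambda>c. \<bar>x_int c\<bar>) \<longlongrightarrow> 1) (at_left (2 / sqrt 3)))"
proof (intro conjI ballI allI impI)
  note bounds = critical_param_bounds
  have abs_cont: "continuous_on {0<..2 / sqrt 3} (\<lambda>c. \<bar>x_int c\<bar>)"
    by (intro continuous_intros continuous_on_x_int)
  \<comment> \<open>Continuity at \<open>c = 1\<close> gives both one-sided limits from the single
    value \<open>s_int 1 = s_bar\<close>.\<close>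
  show "(s_int \<longlongrightarrow> s_bar) (at_left 1)" "(s_int \<longlongrightarrow> s_bar) (at_right 1)"
    using tendsto_at_one[OF continuous_on_s_int] by (simp_all add: s_bar_eq)
  show "((\<lambda>c. \<bar>x_int c\<bar>) \<longlongrightarrow> sqrt (1 + s_bar\<^sup>2)) (at_left 1)"
    "((\<lambda>c. \<bar>x_int c\<bar>) \<longlongrightarrow> sqrt (1 + s_bar\<^sup>2)) (at_right 1)"
    using tendsto_at_one[OF abs_cont] by (simp_all add: abs_x_int_one)
  show "(s_int \<longlongrightarrow> sqrt 3 * pi) (at_left (2 / sqrt 3))"
    using tendsto_at_endpoint[OF continuous_on_s_int] by (simp only: s_int_endpoint)
  show "((\<lambda>c. \<bar>x_int c\<bar>) \<longlongrightarrow> 1) (at_left (2 / sqrt 3))"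
    using tendsto_at_endpoint[OF abs_cont] by (simp only: abs_x_int_endpoint)
  show "s_int differentiable_on {0<..<1}"
    unfolding differentiable_on_def real_differentiable_def
  proof
    fix c :: real assume "c \<in> {0<..<1}"
    then have "0 < c" "c \<noteq> 1" "c < 3 / (2 * sqrt 2)"
      using bounds(1) by (simp_all only: greaterThanLessThan_iff) linarith+
    from DERIV_s_int_neg[OF this]
    show "\<exists>d. (s_int has_real_derivative d) (at c within {0<..<1})"
      using has_field_derivative_at_within by blast
  qed
  \<comment> \<open>Both intervals avoid \<open>1\<close> and lie below
    \<open>3 / (2 * sqrt 2)\<close>, so one sign of the derivative serves both.\<close>
  show "strict_antimono_on {0<..<1} s_int" "strict_antimono_on {1<..<3 / (2 * sqrt 2)} s_int"
    using bounds by (intro strict_antimono_on_if_DERIV_neg DERIV_s_int_neg; linarith)+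
  show "strict_mono_on {3 / (2 * sqrt 2)<..<2 / sqrt 3} s_int"
    by (intro strict_mono_on_if_DERIV_pos DERIV_s_int_pos)
  show "strict_antimono_on {0<..<1} (\<lambda>c. \<bar>x_int c\<bar>)"
    "strict_antimono_on {1<..<2 / sqrt 3} (\<lambda>c. \<bar>x_int c\<bar>)"
    using bounds by (intro strict_antimono_on_abs_x_int; simp)+
  show "continuous_on {1<..<2 / sqrt 3} s_int"
    by (rule continuous_on_subset[OF continuous_on_s_int]) auto
  show "s_int c \<le> s" if "c \<in> {0<..2 / sqrt 3}" "0 < s \<and> geo_y c s = 0" for c s
    using geo_y_pos[of c s] that by (metis greaterThanAtMost_iff less_irrefl not_less)
  show "\<exists>!s. s \<in> {pi<..<3 * pi / 2} \<and> tan s = s"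
    by (rule ex1_tan_eq_self)
  show "filterlim s_int at_top (at_right 0)" by (rule filterlim_s_int_at_right_0)
  show "filterlim (\<lambda>c. \<bar>x_int c\<bar>) at_top (at_right 0)"
    by (rule filterlim_abs_x_int_at_right_0)
  show "s_int (3 / (2 * sqrt 2)) = pi * sqrt 2" by (rule s_int_critical)
  show "0 < s_int c" "geo_y c (s_int c) = 0" if "c \<in> {0<..2 / sqrt 3}" for c
    using that s_int_pos geo_y_s_int by auto
  fix c :: real assume "c \<in> {0<..<1}"
  then have c: "0 < c" "c < 3 / (2 * sqrt 2)" "c < 2 / sqrt 3" using bounds by (simp_all only: greaterThanLessThan_iff) linarith+
  show "pi / c < s_int c" by (rule s_int_gt) (use c in auto)
  show "s_int c < 3 * pi / (2 * c)" by (rule s_int_less_three_halves_pi) (use c in auto)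
  show "x_int c < 0" by (rule x_int_neg) (use c in auto)
qed

end
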